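(* Let $\varepsilon>0$, $\delta>0$ and $c>1$ be such that $\varepsilon^2<4\delta c\,\alpha(c)$, and let $u:\mathbb{R}\to\mathbb{R}$ be the (unique up to horizontal translations) traveling-wave solution of $$-cu - \frac{u}{u-c} + \frac{1}{2}u^2 + \delta c\,u'' - \varepsilon u' = 0 .$$ Then $u(\xi)>0$ for all $\xi\in\mathbb{R}$, and: (a) If $M_0=\sup_{\xi}u(\xi)$, then $M_0$ is attained at a unique value $\xi=z_0$, and $u'(\xi)<0$ for $\xi>z_0$. (b) There is $\xi_0>z_0$ such that $(\xi-\xi_0)u''(\xi)>0$ for all $\xi>z_0$ with $\xi\neq\xi_0$. (c) The solution $u$ has an infinite number of local maxima and minima. These are taken on at points $\{z_i\}_{i=0}^\infty$ (maxima) and $\{w_i\}_{i=1}^\infty$ (minima), where $z_i>w_{i+1}>z_{i+1}$ for all $i\geq 0$, and $\lim_{i\to\infty}z_i=\lim_{i\to\infty}w_i=-\infty$. Moreover, $u_0<u(z_{i+1})<u(z_i)$ for all $i\ge 0$ and $u_0>u(w_{i+1})>u(w_i)$ for all $i\geq 1$.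
   Context: Here $'=d/d\xi$, $$u_0=\frac{3c-\sqrt{c^2+8}}{2},\qquad \alpha(c)=\frac{c-\sqrt{c^2+8}}{2}+\frac{4c}{(c-\sqrt{c^2+8})^2}=u_0-c+\frac{c}{(u_0-c)^2}.$$ A traveling-wave solution is a smooth solution $u$ of the ODE on all of $\mathbb{R}$ (with $u(\xi)\neq c$ for all $\xi$) such that, with $\eta=\dfrac{u}{c-u}$, one has $\lim_{\xi\to-\infty}(\eta(\xi),u(\xi))=(\eta^-,u^-)$ for some finite $\eta^->0$, $u^->0$, $\lim_{\xi\to+\infty}(\eta(\xi),u(\xi))=(0,0)$, and $\lim_{\xi\to\pm\infty}(\eta^{(j)}(\xi),u^{(j)}(\xi))=(0,0)$ for $j=1,2,\dots$. Such a solution exists and is unique up to translations in $\xi$. *)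

theory Defs
  imports "HOL-Analysis.Analysis"
begin

definition u0 :: "real \<Rightarrow> real" where
  "u0 c = (3 * c - sqrt (c\<^sup>2 + 8)) / 2"

definition alpha :: "real \<Rightarrow> real" where
  "alpha c = (c - sqrt (c\<^sup>2 + 8)) / 2 + 4 * c / (c - sqrt (c\<^sup>2 + 8))\<^sup>2"

lemma alpha_eq_u0: "alpha c = u0 c - c + c / (u0 c - c)\<^sup>2"
proof -
  have "u0 c - c = (c - sqrt (c\<^sup>2 + 8)) / 2"
    by (simp add: u0_def field_simps)
  then show ?thesis
    by (simp only: alpha_def power_divide) simp
qed

definition smooth :: "(real \<Rightarrow> real) \<Rightarrow> bool" where
  "smooth f \<longleftrightarrow> (\<forall>j. (deriv ^^ j) f differentiable_on UNIV)"

definition eta :: "real \<Rightarrow> (real \<Rightarrow> real) \<Rightarrow> real \<Rightarrow> real" where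
  "eta c u = (\<lambda>\<xi>. u \<xi> / (c - u \<xi>))"

definition travelling_wave :: "real \<Rightarrow> real \<Rightarrow> real \<Rightarrow> (real \<Rightarrow> real) \<Rightarrow> bool" where
  "travelling_wave \<epsilon> \<delta> c u \<longleftrightarrow>
     smooth u \<and>
     (\<forall>\<xi>. u \<xi> \<noteq> c) \<and>
     (\<forall>\<xi>. - c * u \<xi> - u \<xi> / (u \<xi> - c) + (1/2) * (u \<xi>)\<^sup>2
            + \<delta> * c * deriv (deriv u) \<xi> - \<epsilon> * deriv u \<xi> = 0) \<and>
     (\<exists>\<eta>m um. \<eta>m > 0 \<and> um > 0 \<and> ((\<lambda>\<xi>. (eta c u \<xi>, u \<xi>)) \<longlongrightarrow> (\<eta>m, um)) at_bot) \<and>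
     ((\<lambda>\<xi>. (eta c u \<xi>, u \<xi>)) \<longlongrightarrow> (0, 0)) at_top \<and>
     (\<forall>j\<ge>1. ((\<lambda>\<xi>. ((deriv ^^ j) (eta c u) \<xi>, (deriv ^^ j) u \<xi>)) \<longlongrightarrow> (0, 0)) at_bot \<and>
             ((\<lambda>\<xi>. ((deriv ^^ j) (eta c u) \<xi>, (deriv ^^ j) u \<xi>)) \<longlongrightarrow> (0, 0)) at_top)"

definition local_max_at :: "(real \<Rightarrow> real) \<Rightarrow> real \<Rightarrow> bool" where
  "local_max_at f x \<longleftrightarrow> (\<forall>\<^sub>F y in nhds x. f y \<le> f x)"

definition local_min_at :: "(real \<Rightarrow> real) \<Rightarrow> real \<Rightarrow> bool" where
  "local_min_at f x \<longleftrightarrow> (\<forall>\<^sub>F y in nhds x. f x \<le> f y)"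

end

theory Submission
  imports Defs
begin

text \<open>
  With \<open>k = \<delta> c\<close> the equation reads \<open>k u'' = \<epsilon> u' + f(u)\<close>, where on \<open>u < c\<close> the zeros of \<open>f\<close> are \<open>0\<close> and
  \<open>u\<^sub>0\<close>, \<open>f\<close> is concave for \<open>c > 0\<close> and \<open>f'(u\<^sub>0) = - \<alpha>(c)\<close>.
  For a primitive \<open>F\<close> of \<open>f\<close> the energy \<open>k u'\<^sup>2 / 2 - F(u)\<close> is strictly increasing and tends to \<open>0\<close> at
  \<open>+\<infinity>\<close>, hence is negative, which forbids \<open>u = 0\<close>. At critical points the energy is \<open>- F(u)\<close>, so its growth
  orders the heights of successive maxima and minima, and no equilibrium is met there, so critical
  points are nondegenerate. At \<open>-\<infinity>\<close> the function \<open>exp(- \<epsilon> \<xi> / 2k) (u - u\<^sub>0)\<close> solves \<open>y'' = - q y\<close> with \<open>q\<close>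
  bounded below by a positive constant, because \<open>\<epsilon>\<^sup>2 < 4 k \<alpha>(c)\<close>; a positive solution on
  a left half-line would be concave, hence nonincreasing, with \<open>y''\<close> bounded away from \<open>0\<close>, which is absurd, so \<open>u\<close> oscillates around \<open>u\<^sub>0\<close>. Finally
  \<open>exp(- \<epsilon> \<xi> / k) u''\<close> has derivative \<open>exp(- \<epsilon> \<xi> / k) f'(u) u' / k\<close>; behind the last maximum \<open>u' < 0\<close> and
  \<open>f'(u)\<close> changes sign once, which leaves room for exactly one inflection.
\<close>

subsection \<open>Zeros and sign changes of real functions\<close>

lemma has_real_derivative_pos_imp_signs:
  fixes g :: "real \<Rightarrow> real"
  assumes "(g has_real_derivative l) (at x)" "g x = 0" "l > 0"
  shows "\<exists>d>0. \<forall>h. 0 < h \<and> h < d \<longrightarrow> g (x + h) > 0 \<and> g (x - h) < 0"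
proof -
  obtain d1 where "d1 > 0" "\<And>h. 0 < h \<Longrightarrow> h < d1 \<Longrightarrow> g x < g (x + h)"
    using DERIV_pos_inc_right[OF assms(1,3)] by blast
  moreover obtain d2 where "d2 > 0" "\<And>h. 0 < h \<Longrightarrow> h < d2 \<Longrightarrow> g (x - h) < g x"
    using DERIV_pos_inc_left[OF assms(1,3)] by blast
  ultimately show ?thesis
    using assms(2) by (intro exI[of _ "min d1 d2"]) auto
qed

lemma second_derivative_strict_min:
  fixes f g :: "real \<Rightarrow> real"
  assumes f: "\<And>y. (f has_real_derivative g y) (at y)"
    and g: "(g has_real_derivative l) (at x)" "g x = 0" "l > 0"
  shows "\<exists>d>0. \<forall>y. y \<noteq> x \<and> \<bar>y - x\<bar> < d \<longrightarrow> f x < f y"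
proof -
  obtain d where d: "d > 0" and *: "\<And>h. 0 < h \<Longrightarrow> h < d \<Longrightarrow> g (x + h) > 0 \<and> g (x - h) < 0"
    using has_real_derivative_pos_imp_signs[OF g] by blast
  have cont: "continuous_on S f" for S
    using f by (meson DERIV_isCont continuous_at_imp_continuous_on)
  have "f x < f y" if "y \<noteq> x" "\<bar>y - x\<bar> < d" for y
  proof (cases "x < y")
    case True
    show ?thesis
    proof (rule DERIV_pos_imp_increasing_open[OF True _ cont])
      fix t assume "x < t" "t < y"
      then show "\<exists>z. (f has_real_derivative z) (at t) \<and> z > 0"
        using f[of t] *[of "t - x"] that by auto
    qed
  next
    case False
    then have "y < x" using that by simp
    then show ?thesis
    proof (rule DERIV_neg_imp_decreasing_open[OF _ _ cont])
      fix t assume "y < t" "t < x"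
      then show "\<exists>z. (f has_real_derivative z) (at t) \<and> z < 0"
        using f[of t] *[of "x - t"] that by auto
    qed
  qed
  then show ?thesis using d by blast
qed

text \<open>\<open>g\<close> is positive just right of \<open>p\<close> and negative just left of
  \<open>q\<close>, so it must come back through zero. Applied to the velocity, this rules out two
  neighbouring minima or two neighbouring maxima.\<close>

lemma zero_between_upcrossings:
  fixes g :: "real \<Rightarrow> real"
  assumes "p < q" and cont: "continuous_on {p..q} g"
    and p: "(g has_real_derivative l) (at p)" "g p = 0" "l > 0"
    and q: "(g has_real_derivative m) (at q)" "g q = 0" "m > 0"
  shows "\<exists>x. p < x \<and> x < q \<and> g x = 0"
proof -
  obtain d where d: "d > 0" "\<And>h. 0 < h \<Longrightarrow> h < d \<Longrightarrow> g (p + h) > 0"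
    using has_real_derivative_pos_imp_signs[OF p] by blast
  obtain e where e: "e > 0" "\<And>h. 0 < h \<Longrightarrow> h < e \<Longrightarrow> g (q - h) < 0"
    using has_real_derivative_pos_imp_signs[OF q] by blast
  \<comment> \<open>A third of \<open>q - p\<close> at most, so that \<open>p + h\<close> still lies
    left of \<open>q - h\<close>.\<close>
  define h where "h = min (min d e) (q - p) / 3"
  have h: "0 < h" "h < d" "h < e" "p + h < q - h"
    using d(1) e(1) \<open>p < q\<close> unfolding h_def by (auto simp: min_def field_simps)
  have "\<exists>x\<ge>p + h. x \<le> q - h \<and> g x = 0"
    using h d(2)[OF h(1,2)] e(2)[OF h(1,3)]
    by (intro IVT2') (auto intro!: continuous_on_subset[OF cont])
  then show ?thesis using h by (meson add_increasing2 le_less_trans less_add_same_cancel1 less_le_trans diff_less_eq)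
qed

text \<open>Infinitely many zeros in a compact interval would accumulate, by continuity at another
  zero; but a zero with nonvanishing derivative is isolated.\<close>

lemma finite_simple_zeros:
  fixes g g' :: "real \<Rightarrow> real"
  assumes g: "\<And>x. (g has_real_derivative g' x) (at x)"
    and simple: "\<And>x. g x = 0 \<Longrightarrow> g' x \<noteq> 0"
  shows "finite {x \<in> {a..b}. g x = 0}"
proof (rule ccontr)
  let ?T = "{x \<in> {a..b}. g x = 0}"
  assume "infinite ?T"
  then obtain l where l: "l \<in> {a..b}" "l islimpt ?T"
    using compact_Icc[of a b] unfolding compact_eq_Bolzano_Weierstrass by (metis (no_types, lifting) mem_Collect_eq subsetI)
  have cont: "continuous_on {a..b} g"
    using g by (meson DERIV_isCont continuous_at_imp_continuous_on)
  have "closed ?T"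
    using continuous_closed_preimage_constant[OF cont closed_atLeastAtMost] by simp
  then have gl: "g l = 0" using l(2) closed_limpt by blast
  have "\<exists>d>0. \<forall>h. 0 < h \<and> h < d \<longrightarrow> g (l + h) \<noteq> 0 \<and> g (l - h) \<noteq> 0"
  proof (cases "g' l > 0")
    case True
    then show ?thesis using has_real_derivative_pos_imp_signs[OF g gl] by fastforce
  next
    case False
    then have "- g' l > 0" using simple[OF gl] by simp
    moreover have "((\<lambda>x. - g x) has_real_derivative - g' l) (at l)" by (rule DERIV_minus[OF g])
    ultimately show ?thesis
      using has_real_derivative_pos_imp_signs[of "\<lambda>x. - g x" "- g' l" l] gl by fastforce
  qed
  then obtain d where d: "d > 0" "\<And>h. 0 < h \<Longrightarrow> h < d \<Longrightarrow> g (l + h) \<noteq> 0 \<and> g (l - h) \<noteq> 0" by blast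
  obtain x where x: "x \<in> ?T" "x \<noteq> l" "dist x l < d" using l(2) d(1) unfolding islimpt_approachable by blast
  then show False
    using d(2)[of "\<bar>x - l\<bar>"] by (cases "x < l") (auto simp: dist_real_def)
qed

text \<open>Such a set has the order type of the negative integers: start at its greatest element
  and iterate the predecessor map. The last two properties say that no element is skipped, which
  makes neighbours in the sequence consecutive in \<open>Z\<close>.\<close>

lemma enumerate_discrete_at_bot:
  fixes Z :: "real set"
  assumes fin: "\<And>a. finite (Z \<inter> {a..})" and unb: "\<And>a. \<exists>x\<in>Z. x < a"
  obtains s :: "nat \<Rightarrow> real" where "range s = Z" "\<And>n. s (Suc n) < s n" "filterlim s at_bot sequentially"
    "\<And>n x. x \<in> Z \<Longrightarrow> s (Suc n) < x \<Longrightarrow> s n \<le> x" "\<And>x. x \<in> Z \<Longrightarrow> x \<le> s 0"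
proof -
  \<comment> \<open>Cutting at any member \<open>a\<close> of \<open>Z \<inter> B\<close> leaves a
    finite nonempty set, whose maximum is the maximum of \<open>Z \<inter> B\<close>.\<close>
  have pred: "\<exists>y\<in>Z \<inter> B. \<forall>x\<in>Z \<inter> B. x \<le> y" if "\<exists>a\<in>Z. a \<in> B" for B
  proof -
    obtain a where a: "a \<in> Z" "a \<in> B" using \<open>\<exists>a\<in>Z. a \<in> B\<close> by blast
    have f: "finite (Z \<inter> B \<inter> {a..})" by (rule finite_subset[OF _ fin[of a]]) auto
    have ne: "Z \<inter> B \<inter> {a..} \<noteq> {}" using a by auto
    have "x \<le> Max (Z \<inter> B \<inter> {a..})" if "x \<in> Z \<inter> B" for x
    proof (cases "a \<le> x")
      case True
      then show ?thesis using that f by (intro Max_ge) auto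
    next
      case False
      moreover have "a \<le> Max (Z \<inter> B \<inter> {a..})" using a f by (intro Max_ge) auto
      ultimately show ?thesis by simp
    qed
    then show ?thesis using Max_in[OF f ne] by blast
  qed
  obtain s0 where s0: "s0 \<in> Z" "\<And>x. x \<in> Z \<Longrightarrow> x \<le> s0"
    using pred[of UNIV] unb by auto
  have "\<forall>a. \<exists>y. y \<in> Z \<and> y < a \<and> (\<forall>x\<in>Z. x < a \<longrightarrow> x \<le> y)"
    using pred[of "{..<_}"] unb by (metis IntD1 IntD2 IntI lessThan_iff)
  then obtain P where P: "\<And>a. P a \<in> Z" "\<And>a. P a < a" "\<And>a x. x \<in> Z \<Longrightarrow> x < a \<Longrightarrow> x \<le> P a"
    by metis
  define s where "s n = (P ^^ n) s0" for n
  have s_0: "s 0 = s0" and s_Suc: "s (Suc n) = P (s n)" for n by (simp_all add: s_def)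
  have sZ: "s n \<in> Z" for n by (cases n) (simp_all add: s_0 s_Suc s0 P)
  have dec: "s (Suc n) < s n" for n by (simp add: s_Suc P)
  then have inj: "inj s"
    by (metis linorder_injI neg_less_iff_less less_irrefl
        strict_mono_Suc_iff[of "\<lambda>n. - s n"] strict_monoD)
  have anti: "s n \<le> s m" if "m \<le> n" for m n
    using dec that by (meson lift_Suc_antimono_le less_imp_le)
  have ex: "\<exists>n. s n < a" for a
  proof (rule ccontr)
    assume "\<not> ?thesis"
    then have "range s \<subseteq> Z \<inter> {a..}" using sZ by (auto simp: not_less)
    then have "finite (range s)" using fin finite_subset by blast
    then show False using inj finite_imageD by blast
  qed
  have lim: "filterlim s at_bot sequentially"
    unfolding filterlim_at_bot eventually_sequentially
    by (metis ex anti less_imp_le order_trans)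
  have "x \<in> range s" if "x \<in> Z" for x
  proof -
    \<comment> \<open>At the first index where the sequence has dropped below \<open>x\<close>, the
      preceding term must be \<open>x\<close> itself, since nothing of \<open>Z\<close> lies
      strictly between consecutive terms.\<close>
    define n where "n = (LEAST n. s n < x)"
    have n: "s n < x" unfolding n_def using ex by (rule LeastI_ex)
    have "n \<noteq> 0" using n s0(2)[OF that] s_0 by (metis not_less)
    then obtain k where k: "n = Suc k" using not0_implies_Suc by blast
    have "\<not> s k < x" using not_less_Least[of k "\<lambda>n. s n < x"] k unfolding n_def by simp
    moreover have "\<not> x < s k" using P(3)[OF that, of "s k"] n by (auto simp: k s_Suc)
    ultimately have "x = s k" by simp
    then show ?thesis by simp
  qed
  then have rng: "range s = Z" using sZ by auto
  have gap: "s n \<le> x" if "x \<in> Z" "s (Suc n) < x" for n x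
    using P(3)[OF that(1), of "s n"] that(2) by (force simp: s_Suc)
  have "x \<le> s 0" if "x \<in> Z" for x using s0(2)[OF that] s_0 by simp
  with rng dec lim gap show thesis by (rule that)
qed

subsection \<open>Linear second-order equations\<close>

text \<open>Gronwall's argument in both directions: \<open>w\<close> times
  \<open>exp (C * x)\<close> is nondecreasing and \<open>w\<close> times
  \<open>exp (- C * x)\<close> is nonincreasing, so a zero of the nonnegative \<open>w\<close>
  spreads to the left and to the right.\<close>

lemma linear_growth_zero:
  fixes w w' :: "real \<Rightarrow> real"
  assumes w: "\<And>x. x \<in> {a..b} \<Longrightarrow> (w has_real_derivative w' x) (at x)"
    and bd: "\<And>x. x \<in> {a..b} \<Longrightarrow> \<bar>w' x\<bar> \<le> C * w x"
    and nonneg: "\<And>x. w x \<ge> 0"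
    and r: "r \<in> {a..b}" "w r = 0" and x: "x \<in> {a..b}"
  shows "w x = 0"
proof (cases "x \<le> r")
  case True
  have "w x * exp (C * x) \<le> w r * exp (C * r)"
  proof (rule DERIV_nonneg_imp_nondecreasing[OF True])
    fix t assume "x \<le> t" "t \<le> r"
    then have t: "t \<in> {a..b}" using r x by auto
    have "((\<lambda>t. w t * exp (C * t)) has_real_derivative (w' t + C * w t) * exp (C * t)) (at t)"
      using w[OF t] by (auto intro!: derivative_eq_intros simp: algebra_simps)
    moreover have "(w' t + C * w t) * exp (C * t) \<ge> 0" using bd[OF t] by (auto simp: abs_le_iff)
    ultimately show "\<exists>y. ((\<lambda>t. w t * exp (C * t)) has_real_derivative y) (at t) \<and> 0 \<le> y" by blast
  qed
  then show ?thesis using r nonneg[of x] by (simp add: mult_le_0_iff)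
next
  case False
  then have "r \<le> x" by simp
  then have "w x * exp (- C * x) \<le> w r * exp (- C * r)"
  proof (rule DERIV_nonpos_imp_nonincreasing)
    fix t assume "r \<le> t" "t \<le> x"
    then have t: "t \<in> {a..b}" using r x by auto
    have "((\<lambda>t. w t * exp (- C * t)) has_real_derivative (w' t - C * w t) * exp (- C * t)) (at t)"
      using w[OF t] by (auto intro!: derivative_eq_intros simp: algebra_simps)
    moreover have "(w' t - C * w t) * exp (- C * t) \<le> 0" using bd[OF t] by (auto simp: abs_le_iff mult_le_0_iff)
    ultimately show "\<exists>y. ((\<lambda>t. w t * exp (- C * t)) has_real_derivative y) (at t) \<and> y \<le> 0" by blast
  qed
  then show ?thesis using r nonneg[of x] by (simp add: mult_le_0_iff)
qed

text \<open>Uniqueness for the initial value problem with zero data, obtained from the growth bound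
  for \<open>v\<^sup>2 + v'\<^sup>2\<close>. It serves to show that a nonconstant orbit never rests
  at an equilibrium.\<close>

lemma linear_second_order_zero:
  fixes v v' Q :: "real \<Rightarrow> real"
  assumes v: "\<And>x. (v has_real_derivative v' x) (at x)"
    and v': "\<And>x. (v' has_real_derivative b * v' x + Q x * v x) (at x)"
    and Q: "continuous_on UNIV Q" and r: "v r = 0" "v' r = 0"
  shows "v x = 0"
proof -
  define S where "S = {min r x..max r x}"
  have "bounded (Q ` S)"
    unfolding S_def by (intro compact_imp_bounded compact_continuous_image continuous_on_subset[OF Q]) auto
  then obtain B where B: "\<And>t. t \<in> S \<Longrightarrow> \<bar>Q t\<bar> \<le> B" by (auto simp: bounded_iff)
  let ?w = "\<lambda>t. (v t)\<^sup>2 + (v' t)\<^sup>2"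
  \<comment> \<open>In the derivative of \<open>?w\<close> the mixed term is at most
    \<open>(1 + B) * ?w\<close>, because \<open>2 * v * v'\<close> is bounded by the sum of squares,
    and the damping term is at most \<open>2 * \<bar>b\<bar> * ?w\<close>; this gives
    \<open>C\<close>.\<close>
  have "?w x = 0"
  proof (rule linear_growth_zero[where a = "min r x" and b = "max r x" and r = r and w = ?w and x = x and C = "1 + B + 2 * \<bar>b\<bar>"
        and w' = "\<lambda>t. 2 * v t * v' t * (1 + Q t) + 2 * b * (v' t)\<^sup>2"])
    fix t assume t: "t \<in> {min r x..max r x}"
    show "(?w has_real_derivative 2 * v t * v' t * (1 + Q t) + 2 * b * (v' t)\<^sup>2) (at t)"
      using v[of t] v'[of t] by (auto intro!: derivative_eq_intros simp: algebra_simps power2_eq_square)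
    have "\<bar>2 * v t * v' t\<bar> \<le> ?w t"
      using sum_squares_bound[of "v t" "v' t"] sum_squares_bound[of "- v t" "v' t"] by (auto simp: abs_le_iff)
    moreover have "\<bar>1 + Q t\<bar> \<le> 1 + B" using B[of t] t unfolding S_def by (auto simp: abs_le_iff)
    ultimately have "\<bar>2 * v t * v' t\<bar> * \<bar>1 + Q t\<bar> \<le> ?w t * (1 + B)" by (intro mult_mono) auto
    moreover have "\<bar>2 * b * (v' t)\<^sup>2\<bar> \<le> 2 * \<bar>b\<bar> * ?w t"
      by (simp add: abs_mult mult_left_mono)
    moreover have "\<bar>2 * v t * v' t * (1 + Q t) + 2 * b * (v' t)\<^sup>2\<bar>
        \<le> \<bar>2 * v t * v' t\<bar> * \<bar>1 + Q t\<bar> + \<bar>2 * b * (v' t)\<^sup>2\<bar>"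
      by (metis abs_mult abs_triangle_ineq)
    ultimately show "\<bar>2 * v t * v' t * (1 + Q t) + 2 * b * (v' t)\<^sup>2\<bar> \<le> (1 + B + 2 * \<bar>b\<bar>) * ?w t"
      by (simp add: algebra_simps)
  qed (use r in auto)
  then show ?thesis by simp
qed

lemma no_positive_solution_at_bot:
  fixes y y' y'' :: "real \<Rightarrow> real"
  assumes y: "\<And>x. (y has_real_derivative y' x) (at x)"
    and y': "\<And>x. (y' has_real_derivative y'' x) (at x)"
    and m: "m > 0" and le: "\<And>x. x \<le> A \<Longrightarrow> y'' x \<le> - m * y x"
    and pos: "\<And>x. x \<le> A \<Longrightarrow> y x > 0"
  shows False
proof -
  have anti: "y' b \<le> y' a" if "a \<le> b" "b \<le> A" for a b
  proof (rule DERIV_nonpos_imp_nonincreasing[OF that(1)])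
    fix t assume "a \<le> t" "t \<le> b"
    then have "t \<le> A" using that by simp
    then have "y'' t \<le> 0" using le[of t] pos[of t] m by (smt (verit) mult_neg_pos)
    then show "\<exists>z. (y' has_real_derivative z) (at t) \<and> z \<le> 0" using y' by blast
  qed
  have npos: "y' x \<le> 0" if "x \<le> A" for x
  proof (rule ccontr)
    assume "\<not> y' x \<le> 0"
    then have p: "y' x > 0" by simp
    \<comment> \<open>The zero of the tangent at \<open>x\<close>; a concave graph lies below its
      tangent, so \<open>y\<close> could not be positive there.\<close>
    define t where "t = x - y x / y' x"
    have t: "t < x" using p pos[OF that] by (simp add: t_def)
    obtain z where z: "t < z" "z < x" "y x - y t = (x - t) * y' z"
      using MVT2[OF t, of y y'] y by blast
    have "(x - t) * y' z \<ge> (x - t) * y' x"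
      using anti[of z x] z t that by (intro mult_left_mono) auto
    moreover have "(x - t) * y' x = y x" using p by (simp add: t_def)
    ultimately show False using z pos[of t] t that by simp
  qed
  have ymin: "y A \<le> y x" if "x \<le> A" for x
    using that by (rule DERIV_nonpos_imp_nonincreasing) (use y npos in blast)
  \<comment> \<open>Left of \<open>A\<close> the second derivative is at most
    \<open>- m * y A\<close>. Going back this far raises the slope from \<open>y' A\<close> to at
    least 1, against \<open>npos\<close>.\<close>
  define t where "t = A - (1 - y' A) / (m * y A)"
  have mu: "m * y A > 0" using m pos[of A] by simp
  have t: "t < A" using mu npos[of A] by (simp add: t_def)
  obtain z where z: "t < z" "z < A" "y' A - y' t = (A - t) * y'' z"
    using MVT2[OF t, of y' y''] y' by blast
  have "y'' z \<le> - (m * y A)"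
    using le[of z] ymin[of z] z m by (smt (verit) mult_left_mono mult_minus_left)
  then have "(A - t) * y'' z \<le> (A - t) * - (m * y A)" using t by (intro mult_left_mono) auto
  moreover have "(A - t) * - (m * y A) = - (1 - y' A)" using mu m pos[of A] by (simp add: t_def)
  ultimately show False using z npos[of t] t by simp
qed

subsection \<open>The force and its potential\<close>

text \<open>Clearing denominators in \<open>c - x / 2 = 1 / (c - x)\<close>, the condition for a
  nonzero equilibrium, gives this quadratic. Its other root is \<open>3 * c - u0 c\<close>, which
  lies above \<open>c\<close>.\<close>

lemma u0_root: "(u0 c)\<^sup>2 - 3 * c * u0 c + 2 * c\<^sup>2 - 2 = 0"
proof -
  have "(sqrt (c\<^sup>2 + 8))\<^sup>2 = c\<^sup>2 + 8" by (simp add: add_nonneg_pos)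
  then show ?thesis unfolding u0_def by (simp add: power2_eq_square field_simps)
qed

lemma u0_less: "u0 c < c"
proof -
  have "c < sqrt (c\<^sup>2 + 8)" by (rule real_less_rsqrt) simp
  then show ?thesis by (simp add: u0_def)
qed

lemma u0_pos:
  assumes "c > 1"
  shows "u0 c > 0"
proof -
  have "1 < c\<^sup>2" using assms by (simp add: one_less_power)
  then have "sqrt (c\<^sup>2 + 8) < 3 * c" using assms by (intro real_less_lsqrt) (auto simp: power_mult_distrib)
  then show ?thesis by (simp add: u0_def)
qed

definition force :: "real \<Rightarrow> real \<Rightarrow> real" where
  "force c x = c * x - x\<^sup>2 / 2 - x / (c - x)"

definition force' :: "real \<Rightarrow> real \<Rightarrow> real" where
  "force' c x = c - x - c / (c - x)\<^sup>2"

text \<open>The primitive of \<open>force c\<close> normalised by the constant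
  \<open>c * ln c\<close> to vanish at 0, so that the energy tends to 0 along with the wave.\<close>

definition potential :: "real \<Rightarrow> real \<Rightarrow> real" where
  "potential c x = c * x\<^sup>2 / 2 - x ^ 3 / 6 + x + c * ln (c - x) - c * ln c"

text \<open>The quotient of \<open>- force c x\<close> by \<open>x - u0 c\<close> with the common
  factor cancelled; it therefore keeps its meaning at the equilibrium \<open>u0 c\<close>.\<close>

definition stiffness :: "real \<Rightarrow> real \<Rightarrow> real" where
  "stiffness c x = x * (3 * c - u0 c - x) / (2 * (c - x))"

lemma force_factor:
  assumes "x < c"
  shows "force c x = - stiffness c x * (x - u0 c)"
proof -
  \<comment> \<open>The numerator of the force is \<open>x\<close> times the quadratic of
    \<open>u0_root\<close>, here split into its two linear factors.\<close>
  have *: "(c * x - x\<^sup>2 / 2) * (2 * (c - x)) - 2 * x = - x * (3 * c - u0 c - x) * (x - u0 c)"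
    using u0_root[of c] by algebra
  have "force c x * (2 * (c - x)) = (c * x - x\<^sup>2 / 2) * (2 * (c - x)) - x / (c - x) * (2 * (c - x))"
    unfolding force_def by (simp only: left_diff_distrib)
  also have "x / (c - x) * (2 * (c - x)) = 2 * (x / (c - x) * (c - x))" by (simp only: mult.left_commute)
  also have "x / (c - x) * (c - x) = x" using assms by simp
  also note *
  finally have "force c x = - x * (3 * c - u0 c - x) * (x - u0 c) / (2 * (c - x))"
    using assms by (subst eq_divide_eq) auto
  then show ?thesis by (simp add: stiffness_def)
qed

lemma stiffness_pos: "0 < x \<Longrightarrow> x < c \<Longrightarrow> stiffness c x > 0"
  using u0_less[of c] unfolding stiffness_def by (intro divide_pos_pos mult_pos_pos) auto

text \<open>Links the factorisation to the threshold: the cancelled quotient takes at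
  \<open>u0 c\<close> the value of minus the slope of the force there, which is
  \<open>alpha c\<close>.\<close>

lemma stiffness_u0: "stiffness c (u0 c) = alpha c"
proof -
  have d: "c - u0 c \<noteq> 0" "(u0 c - c) \<noteq> 0" using u0_less[of c] by auto
  have "u0 c * (3 * c - u0 c - u0 c) * (u0 c - c)\<^sup>2 = 2 * (c - u0 c) * ((u0 c - c) ^ 3 + c)"
    using u0_root[of c] by algebra
  moreover have "alpha c = ((u0 c - c) ^ 3 + c) / (u0 c - c)\<^sup>2"
    unfolding alpha_eq_u0 using d by (simp add: add_divide_distrib power2_eq_square power3_eq_cube)
  ultimately show ?thesis
    unfolding stiffness_def using d by (simp add: frac_eq_eq mult.commute)
qed

lemma force_pos: "0 < x \<Longrightarrow> x < u0 c \<Longrightarrow> force c x > 0"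
  using force_factor[of x c] stiffness_pos[of x c] u0_less[of c] by (simp add: mult_less_0_iff)

lemma force_neg: "0 < x \<Longrightarrow> u0 c < x \<Longrightarrow> x < c \<Longrightarrow> force c x < 0"
  using force_factor[of x c] stiffness_pos[of x c] by simp

lemma DERIV_force: "x < c \<Longrightarrow> (force c has_real_derivative force' c x) (at x)"
  unfolding force_def[abs_def] force'_def
  by (auto intro!: derivative_eq_intros simp: field_simps power2_eq_square)

lemma DERIV_potential: "x < c \<Longrightarrow> (potential c has_real_derivative force c x) (at x)"
  unfolding potential_def[abs_def] force_def
  by (auto intro!: derivative_eq_intros simp: divide_simps power2_eq_square) (auto simp: algebra_simps power2_eq_square)

lemma force'_strict_antimono: "c > 0 \<Longrightarrow> x < y \<Longrightarrow> y < c \<Longrightarrow> force' c y < force' c x"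
  unfolding force'_def by (intro diff_strict_mono divide_strict_left_mono power_strict_mono mult_pos_pos diff_strict_left_mono) auto

lemma continuous_on_potential: "(\<And>x. x \<in> S \<Longrightarrow> x < c) \<Longrightarrow> continuous_on S (potential c)"
  by (meson DERIV_isCont DERIV_potential continuous_at_imp_continuous_on)

lemma potential_increasing:
  assumes "0 \<le> x" "x < y" "y \<le> u0 c"
  shows "potential c x < potential c y"
proof (rule DERIV_pos_imp_increasing_open[OF assms(2)])
  fix t assume "x < t" "t < y"
  then have "t < c" "force c t > 0" using assms u0_less[of c] by (auto intro: force_pos)
  then show "\<exists>d. (potential c has_real_derivative d) (at t) \<and> 0 < d" using DERIV_potential by blast
next
  show "continuous_on {x..y} (potential c)"
    using assms u0_less[of c] by (intro continuous_on_potential) auto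
qed

lemma potential_decreasing:
  assumes "c > 1" "u0 c \<le> x" "x < y" "y < c"
  shows "potential c y < potential c x"
proof (rule DERIV_neg_imp_decreasing_open[OF assms(3)])
  fix t assume "x < t" "t < y"
  then have "t < c" "force c t < 0" using assms u0_pos[OF assms(1)] by (auto intro!: force_neg)
  then show "\<exists>d. (potential c has_real_derivative d) (at t) \<and> d < 0" using DERIV_potential by blast
next
  show "continuous_on {x..y} (potential c)"
    using assms by (intro continuous_on_potential) auto
qed

subsection \<open>The orbit joining the two equilibria\<close>

text \<open>The phase-plane form of the problem, with velocity \<open>v\<close> and \<open>k\<close>
  standing for \<open>\<delta> * c\<close>. The orbit stays on one side of the singular line
  \<open>u = c\<close>, and its left limit is already identified.\<close>

locale wave_orbit =
  fixes k \<epsilon> c :: real and u v :: "real \<Rightarrow> real"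
  assumes k: "k > 0" and eps: "\<epsilon> > 0" and c: "c > 1" and eps_less: "\<epsilon>\<^sup>2 < 4 * k * alpha c"
    and u_less: "u x < c"
    and du: "(u has_real_derivative v x) (at x)"
    and dv: "(v has_real_derivative (\<epsilon> * v x + force c (u x)) / k) (at x)"
    and u_top: "(u \<longlongrightarrow> 0) at_top" and v_top: "(v \<longlongrightarrow> 0) at_top"
    and u_bot: "(u \<longlongrightarrow> u0 c) at_bot"
begin

definition acc :: "real \<Rightarrow> real" where "acc x = (\<epsilon> * v x + force c (u x)) / k"

lemma dv_acc: "(v has_real_derivative acc x) (at x)" using dv unfolding acc_def .

lemma alpha_pos: "alpha c > 0"
  using eps_less eps k by (smt (verit) mult_nonneg_nonpos zero_less_power)

lemma cont_u: "continuous_on S u" and cont_v: "continuous_on S v"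
  using du dv by (meson DERIV_isCont continuous_at_imp_continuous_on)+

lemma not_constant_u: "\<exists>x. u x \<noteq> p"
proof (rule ccontr)
  assume "\<not> ?thesis"
  then have "u = (\<lambda>x. p)" by auto
  then have "p = 0" "p = u0 c" using u_top u_bot by (simp_all add: tendsto_const_iff)
  then show False using u0_pos[OF c] by simp
qed

text \<open>If the orbit were at rest at an equilibrium \<open>p\<close>, then \<open>u - p\<close>
  would solve a linear equation with zero data, so \<open>u\<close> would be constant, although its
  limits \<open>0\<close> and \<open>u0 c\<close> differ.\<close>

lemma not_equilibrium:
  assumes "v r = 0" shows "force c (u r) \<noteq> 0"
proof
  assume "force c (u r) = 0"
  moreover have "force c (u r) = - (u r - u0 c) * stiffness c (u r)"
    using force_factor[OF u_less[of r]] by (simp add: algebra_simps)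
  ultimately have "u r = u0 c \<or> u r = 0"
    using u_less[of r] u0_less[of c] c by (auto simp: stiffness_def)
  \<comment> \<open>Dividing the force by \<open>x - p\<close> with a continuous quotient makes the
    equation linear in \<open>u - p\<close>; each of the two equilibria has its own explicit
    quotient.\<close>
  then obtain p Q where p: "p = u r" and Q: "\<And>x. x < c \<Longrightarrow> force c x = Q x * (x - p)"
    and cQ: "continuous_on {..<c} Q"
  proof
    assume a: "u r = u0 c"
    show ?thesis
    proof (rule that[of "u0 c" "\<lambda>x. - stiffness c x"])
      show "continuous_on {..<c} (\<lambda>x. - stiffness c x)"
        unfolding stiffness_def by (auto intro!: continuous_intros)
    qed (use a force_factor in auto)
  next
    assume a: "u r = 0"
    show ?thesis
    proof (rule that[of 0 "\<lambda>x. c - x / 2 - 1 / (c - x)"])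
      show "continuous_on {..<c} (\<lambda>x. c - x / 2 - 1 / (c - x))"
        by (auto intro!: continuous_intros)
    qed (use a in \<open>auto simp: force_def algebra_simps power2_eq_square\<close>)
  qed
  have "u x - p = 0" for x
  proof (rule linear_second_order_zero[where v = "\<lambda>x. u x - p" and v' = v and b = "\<epsilon> / k"
        and Q = "\<lambda>x. Q (u x) / k" and r = r])
    show "((\<lambda>x. u x - p) has_real_derivative v x) (at x)" for x
      using du[of x] by (auto intro!: derivative_eq_intros)
    show "(v has_real_derivative \<epsilon> / k * v x + Q (u x) / k * (u x - p)) (at x)" for x
      using dv[of x] Q[OF u_less[of x]] by (simp add: add_divide_distrib)
    show "continuous_on UNIV (\<lambda>x. Q (u x) / k)"
      using u_less k by (auto intro!: continuous_intros continuous_on_compose2[OF cQ cont_u])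
  qed (use assms p in auto)
  then show False using not_constant_u[of p] by simp
qed

lemma acc_nonzero: "v r = 0 \<Longrightarrow> acc r \<noteq> 0"
  using not_equilibrium[of r] k by (simp add: acc_def)

section \<open>Growth of the energy and positivity of the wave\<close>

definition energy :: "real \<Rightarrow> real" where
  "energy x = k * (v x)\<^sup>2 / 2 - potential c (u x)"

lemma d_energy: "(energy has_real_derivative \<epsilon> * (v x)\<^sup>2) (at x)"
proof -
  have "((\<lambda>x. potential c (u x)) has_real_derivative force c (u x) * v x) (at x)"
    by (rule DERIV_chain2[OF DERIV_potential[OF u_less] du])
  then have "(energy has_real_derivative k * (2 * v x * acc x) / 2 - force c (u x) * v x) (at x)"
    unfolding energy_def[abs_def] using dv_acc[of x] by (auto intro!: derivative_eq_intros)
  moreover have "k * (2 * v x * acc x) / 2 - force c (u x) * v x = \<epsilon> * (v x)\<^sup>2"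
    using k by (simp add: acc_def field_simps power2_eq_square)
  ultimately show ?thesis by simp
qed

text \<open>The derivative vanishes wherever \<open>v\<close> does, so strictness needs an argument:
  equal energies at two points would make \<open>v\<close> vanish on a whole interval, hence also
  \<open>acc\<close>, which happens only at an equilibrium.\<close>

lemma energy_less:
  assumes "a < b" shows "energy a < energy b"
proof -
  have mono: "energy s \<le> energy t" if "s \<le> t" for s t
    using that by (rule DERIV_nonneg_imp_nondecreasing) (use d_energy eps in force)
  have "energy a \<noteq> energy b"
  proof
    assume eq: "energy a = energy b"
    have v0: "v x = 0" if x: "a < x" "x < b" for x
    proof -
      have const: "energy y = energy a" if "a < y" "y < b" for y
        using mono[of a y] mono[of y b] that eq by simp
      have "(energy has_real_derivative 0) (at x)"
        by (rule has_field_derivative_transform_within_open[where f = "\<lambda>_. energy a" and S = "{a<..<b}"])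
           (use x const in auto)
      then have "\<epsilon> * (v x)\<^sup>2 = 0" using d_energy DERIV_unique by blast
      then show ?thesis using eps by simp
    qed
    let ?x = "(a + b) / 2"
    have x: "a < ?x" "?x < b" using assms by auto
    have "(v has_real_derivative 0) (at ?x)"
      by (rule has_field_derivative_transform_within_open[where f = "\<lambda>_. 0" and S = "{a<..<b}"])
         (use x v0 in auto)
    then have "acc ?x = 0" using dv_acc DERIV_unique by blast
    then show False using acc_nonzero v0 x by blast
  qed
  then show ?thesis using mono[of a b] assms by simp
qed

lemma energy_neg: "energy x < 0"
proof -
  have "isCont (potential c) 0" using DERIV_isCont[OF DERIV_potential] c by simp
  then have "((\<lambda>x. potential c (u x)) \<longlongrightarrow> potential c 0) at_top"
    using u_top isCont_tendsto_compose by blast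
  then have "(energy \<longlongrightarrow> k * 0\<^sup>2 / 2 - potential c 0) at_top"
    unfolding energy_def[abs_def] by (intro tendsto_intros v_top) auto
  then have "(energy \<longlongrightarrow> 0) at_top" by (simp add: potential_def)
  \<comment> \<open>The limit gives only a weak bound; taking it at \<open>x + 1\<close> leaves room
    for strict growth between \<open>x\<close> and \<open>x + 1\<close>.\<close>
  then have "energy (x + 1) \<le> 0"
    by (rule tendsto_lowerbound)
       (auto simp: eventually_at_top_linorder intro!: exI[of _ "x + 2"] less_imp_le[OF energy_less])
  then show ?thesis using energy_less[of x "x + 1"] by simp
qed

text \<open>The wave is positive near \<open>-infinity\<close>, so a nonpositive value would force a
  zero of \<open>u\<close>, where the energy is purely kinetic and thus nonnegative.\<close>

lemma u_pos: "u x > 0"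
proof (rule ccontr)
  assume "\<not> u x > 0"
  then have le: "u x \<le> 0" by simp
  have "eventually (\<lambda>y. u y > 0) at_bot"
    using order_tendstoD(1)[OF u_bot u0_pos[OF c]] .
  then obtain N where N: "\<And>y. y \<le> N \<Longrightarrow> u y > 0" by (auto simp: eventually_at_bot_linorder)
  have "\<exists>y\<ge>min N x. y \<le> x \<and> u y = 0"
    by (rule IVT2') (use le N[of "min N x"] cont_u in auto)
  then obtain y where "u y = 0" by blast
  then have "energy y \<ge> 0" using k by (simp add: energy_def potential_def)
  then show False using energy_neg[of y] by simp
qed

section \<open>Classification of the critical points\<close>

lemma u_ne_u0: "v r = 0 \<Longrightarrow> u r \<noteq> u0 c"
  using not_equilibrium[of r] force_factor[OF u_less[of r]] by auto

text \<open>At a critical point the damping term drops out and the sign of the force decides, so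
  maxima lie above \<open>u0 c\<close> and minima below it.\<close>

lemma acc_neg_iff: "v r = 0 \<Longrightarrow> acc r < 0 \<longleftrightarrow> u r > u0 c"
  using u_ne_u0[of r] force_pos[OF u_pos[of r]] force_neg[OF u_pos[of r] _ u_less] k
  by (cases "u r < u0 c") (force simp: acc_def divide_less_0_iff)+

lemma acc_pos_iff: "v r = 0 \<Longrightarrow> acc r > 0 \<longleftrightarrow> u r < u0 c"
  using acc_neg_iff[of r] acc_nonzero[of r] u_ne_u0[of r] by auto

lemma d_minus_u: "((\<lambda>x. - u x) has_real_derivative - v x) (at x)"
  and d_minus_v: "((\<lambda>x. - v x) has_real_derivative - acc x) (at x)"
  using du dv_acc by (auto intro: DERIV_minus)

lemma strict_min:
  "v x = 0 \<Longrightarrow> acc x > 0 \<Longrightarrow> \<exists>d>0. \<forall>y. y \<noteq> x \<and> \<bar>y - x\<bar> < d \<longrightarrow> u x < u y"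
  using second_derivative_strict_min[OF du dv_acc] .

lemma strict_max:
  "v x = 0 \<Longrightarrow> acc x < 0 \<Longrightarrow> \<exists>d>0. \<forall>y. y \<noteq> x \<and> \<bar>y - x\<bar> < d \<longrightarrow> u y < u x"
  using second_derivative_strict_min[OF d_minus_u d_minus_v, of x] by simp

text \<open>Nondegeneracy makes the second derivative test necessary as well as sufficient: were
  \<open>acc x\<close> positive, points close to \<open>x\<close> would lie strictly higher.\<close>

lemma local_max_iff: "local_max_at u x \<longleftrightarrow> v x = 0 \<and> acc x < 0"
proof
  assume "local_max_at u x"
  then obtain d where d: "d > 0" "\<And>y. \<bar>y - x\<bar> < d \<Longrightarrow> u y \<le> u x"
    by (auto simp: local_max_at_def eventually_nhds_metric dist_real_def)
  have v0: "v x = 0" by (rule DERIV_local_max[OF du d(1)]) (use d(2) in \<open>auto simp: abs_minus_commute\<close>)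
  have "\<not> acc x > 0"
  proof
    assume "acc x > 0"
    then obtain e where e: "e > 0" "\<And>y. y \<noteq> x \<Longrightarrow> \<bar>y - x\<bar> < e \<Longrightarrow> u x < u y"
      using strict_min[OF v0] by blast
    show False using d(2)[of "x + min d e / 2"] e(2)[of "x + min d e / 2"] d(1) e(1)
      by (cases "d \<le> e") auto
  qed
  then show "v x = 0 \<and> acc x < 0" using v0 acc_nonzero[OF v0] by auto
next
  assume "v x = 0 \<and> acc x < 0"
  then obtain d where "d > 0" "\<And>y. y \<noteq> x \<Longrightarrow> \<bar>y - x\<bar> < d \<Longrightarrow> u y < u x"
    using strict_max by blast
  then show "local_max_at u x"
    unfolding local_max_at_def eventually_nhds_metric dist_real_def
    by (intro exI[of _ d]) (metis less_le order_refl)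
qed

lemma local_min_iff: "local_min_at u x \<longleftrightarrow> v x = 0 \<and> acc x > 0"
proof
  assume "local_min_at u x"
  then obtain d where d: "d > 0" "\<And>y. \<bar>y - x\<bar> < d \<Longrightarrow> u x \<le> u y"
    by (auto simp: local_min_at_def eventually_nhds_metric dist_real_def)
  have v0: "v x = 0" by (rule DERIV_local_min[OF du d(1)]) (use d(2) in \<open>auto simp: abs_minus_commute\<close>)
  have "\<not> acc x < 0"
  proof
    assume "acc x < 0"
    then obtain e where e: "e > 0" "\<And>y. y \<noteq> x \<Longrightarrow> \<bar>y - x\<bar> < e \<Longrightarrow> u y < u x"
      using strict_max[OF v0] by blast
    show False using d(2)[of "x + min d e / 2"] e(2)[of "x + min d e / 2"] d(1) e(1)
      by (cases "d \<le> e") auto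
  qed
  then show "v x = 0 \<and> acc x > 0" using v0 acc_nonzero[OF v0] by auto
next
  assume "v x = 0 \<and> acc x > 0"
  then obtain d where "d > 0" "\<And>y. y \<noteq> x \<Longrightarrow> \<bar>y - x\<bar> < d \<Longrightarrow> u x < u y"
    using strict_min by blast
  then show "local_min_at u x"
    unfolding local_min_at_def eventually_nhds_metric dist_real_def
    by (intro exI[of _ d]) (metis less_le order_refl)
qed

text \<open>Right after \<open>x\<close> the wave rises above \<open>u x\<close>, yet it tends to 0,
  which is below \<open>u x\<close>; the maximum over a long enough interval is therefore
  interior.\<close>

lemma minimum_followed_by_maximum:
  assumes "v x = 0" "acc x > 0"
  shows "\<exists>y>x. v y = 0 \<and> acc y < 0"
proof -
  obtain d where d: "d > 0" "\<And>y. y \<noteq> x \<Longrightarrow> \<bar>y - x\<bar> < d \<Longrightarrow> u x < u y"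
    using strict_min[OF assms] by blast
  have "eventually (\<lambda>y. u y < u x) at_top" using order_tendstoD(2)[OF u_top u_pos] .
  then obtain R where R: "\<And>y. y \<ge> R \<Longrightarrow> u y < u x" by (auto simp: eventually_at_top_linorder)
  \<comment> \<open>Beyond \<open>R\<close> the endpoint is lower than \<open>u x\<close>; beyond
    \<open>x + d\<close> the interval contains the higher point \<open>x + d / 2\<close>.\<close>
  define b where "b = max R (x + d)"
  have b: "u b < u x" "x + d \<le> b" using R by (auto simp: b_def)
  obtain y where y: "y \<in> {x..b}" "\<And>t. t \<in> {x..b} \<Longrightarrow> u t \<le> u y"
    using continuous_attains_sup[of "{x..b}" u] cont_u b d(1) by auto
  have "u x < u (x + d / 2)" using d by simp
  also have "\<dots> \<le> u y" using b d(1) by (intro y) auto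
  finally have "y \<noteq> x" "y \<noteq> b" using b by auto
  then have "x < y" "y < b" using y(1) by auto
  moreover have "local_max_at u y"
    unfolding local_max_at_def
    using eventually_nhds_in_open[of "{x<..<b}" y] \<open>x < y\<close> \<open>y < b\<close> y(2)
    by (auto elim!: eventually_mono)
  ultimately show ?thesis using local_max_iff by blast
qed

text \<open>Once \<open>u\<close> stays below \<open>u0 c\<close>, any critical point is a minimum,
  and the maximum that must follow it would have to lie above \<open>u0 c\<close>.\<close>

lemma zeros_bounded_above: "\<exists>T. \<forall>x. v x = 0 \<longrightarrow> x \<le> T"
proof -
  have "eventually (\<lambda>y. u y < u0 c) at_top" using order_tendstoD(2)[OF u_top u0_pos[OF c]] .
  then obtain T where T: "\<And>y. y \<ge> T \<Longrightarrow> u y < u0 c" by (auto simp: eventually_at_top_linorder)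
  have "x \<le> T" if v0: "v x = 0" for x
  proof (rule ccontr)
    assume "\<not> x \<le> T"
    then have "acc x > 0" using T[of x] acc_pos_iff[OF v0] by simp
    then obtain y where "y > x" "v y = 0" "acc y < 0"
      using minimum_followed_by_maximum[OF v0] by blast
    then show False using T[of y] \<open>\<not> x \<le> T\<close> acc_neg_iff[of y] by simp
  qed
  then show ?thesis by blast
qed

section \<open>Oscillation about the equilibrium at \<open>-infinity\<close>\<close>

lemma crosses_u0: "\<exists>x<a. u x = u0 c"
proof (rule ccontr)
  assume no: "\<not> ?thesis"
  \<comment> \<open>Half the damping rate: the weight \<open>exp (- \<nu> * x)\<close> removes the
    first-order term.\<close>
  define \<nu> where "\<nu> = \<epsilon> / (2 * k)"
  have "isCont (stiffness c) (u0 c)"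
    unfolding stiffness_def[abs_def] using u0_less[of c] by (auto intro!: continuous_intros)
  then have lim: "((\<lambda>x. stiffness c (u x)) \<longlongrightarrow> alpha c) at_bot"
    using u_bot isCont_tendsto_compose stiffness_u0 by metis
  \<comment> \<open>The midpoint between the critical damping level and the limit of the stiffness.
    The gap, open because of \<open>eps_less\<close>, keeps the coefficient \<open>m\<close>
    positive on a whole left half-line.\<close>
  define \<beta> where "\<beta> = (\<epsilon>\<^sup>2 / (4 * k) + alpha c) / 2"
  have "\<epsilon>\<^sup>2 / (4 * k) < alpha c" using eps_less k by (simp add: field_simps)
  then have \<beta>: "\<epsilon>\<^sup>2 / (4 * k) < \<beta>" "\<beta> < alpha c" by (auto simp: \<beta>_def)
  obtain N where N: "\<And>x. x \<le> N \<Longrightarrow> stiffness c (u x) > \<beta>"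
    using order_tendstoD(1)[OF lim \<beta>(2)] by (auto simp: eventually_at_bot_linorder)
  define A where "A = min N (a - 1)"
  define m where "m = (\<beta> - \<epsilon>\<^sup>2 / (4 * k)) / k"
  have m: "m > 0" using \<beta> k by (simp add: m_def)
  \<comment> \<open>The sign \<open>\<sigma>\<close> treats orbits above and below
    \<open>u0 c\<close> at once.\<close>
  have impossible: False if \<sigma>: "\<sigma> = 1 \<or> \<sigma> = - 1" and pos: "\<And>x. x \<le> A \<Longrightarrow> \<sigma> * (u x - u0 c) > 0" for \<sigma> :: real
  proof -
    let ?y = "\<lambda>x. \<sigma> * exp (- \<nu> * x) * (u x - u0 c)"
    let ?y' = "\<lambda>x. \<sigma> * exp (- \<nu> * x) * (v x - \<nu> * (u x - u0 c))"
    let ?y'' = "\<lambda>x. \<sigma> * exp (- \<nu> * x) * (acc x - 2 * \<nu> * v x + \<nu>\<^sup>2 * (u x - u0 c))"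
    show False
    proof (rule no_positive_solution_at_bot[where y = ?y and y' = ?y' and y'' = ?y'' and m = m and A = A])
      show "(?y has_real_derivative ?y' x) (at x)" for x
        using du[of x] by (auto intro!: derivative_eq_intros simp: algebra_simps)
      show "(?y' has_real_derivative ?y'' x) (at x)" for x
        using du[of x] dv_acc[of x] by (auto intro!: derivative_eq_intros simp: algebra_simps power2_eq_square)
      fix x assume x: "x \<le> A"
      show p: "?y x > 0" using pos[OF x] by (simp add: mult.assoc mult.left_commute[of \<sigma>])
      have "acc x - 2 * \<nu> * v x + \<nu>\<^sup>2 * (u x - u0 c) = - ((stiffness c (u x) - \<epsilon>\<^sup>2 / (4 * k)) / k) * (u x - u0 c)"
        unfolding acc_def force_factor[OF u_less[of x]]
        using k by (simp add: \<nu>_def field_simps power2_eq_square)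
      then have "?y'' x = - ((stiffness c (u x) - \<epsilon>\<^sup>2 / (4 * k)) / k) * ?y x" by (simp only: ac_simps)
      also have "\<dots> \<le> - m * ?y x"
        using N[of x] x p k unfolding m_def by (intro mult_right_mono) (auto simp: A_def divide_right_mono)
      finally show "?y'' x \<le> - m * ?y x" .
    qed (rule m)
  qed
  \<comment> \<open>Without a crossing, \<open>u - u0 c\<close> keeps on the left half-line the sign
    it has at \<open>A\<close>.\<close>
  have ne: "u x \<noteq> u0 c" if "x \<le> A" for x using no that by (auto simp: A_def)
  show False
  proof (cases "u A > u0 c")
    case True
    have "1 * (u x - u0 c) > 0" if "x \<le> A" for x
    proof (rule ccontr)
      assume "\<not> 1 * (u x - u0 c) > 0"
      then have "\<exists>y\<ge>x. y \<le> A \<and> u y = u0 c" using True that by (intro IVT') (auto intro: cont_u)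
      then show False using ne by auto
    qed
    then show False using impossible[of 1] by blast
  next
    case False
    have "- 1 * (u x - u0 c) > 0" if "x \<le> A" for x
    proof (rule ccontr)
      assume "\<not> - 1 * (u x - u0 c) > 0"
      then have "\<exists>y\<ge>x. y \<le> A \<and> u y = u0 c" using False that by (intro IVT2') (auto intro: cont_u)
      then show False using ne by auto
    qed
    then show False using impossible[of "- 1"] by blast
  qed
qed

lemma zeros_unbounded_below: "\<exists>x<a. v x = 0"
proof -
  obtain q where q: "q < a" "u q = u0 c" using crosses_u0 by blast
  obtain p where p: "p < q" "u p = u0 c" using crosses_u0 by blast
  have "\<exists>z>p. z < q \<and> (u has_real_derivative 0) (at z)"
    using Rolle[OF p(1)] p q cont_u du real_differentiable_def by metis
  then obtain z where "z < q" "(u has_real_derivative 0) (at z)" by blast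
  then have "v z = 0" "z < a" using DERIV_unique[OF du[of z]] q by auto
  then show ?thesis by blast
qed

lemma zeros_finite: "finite ({x. v x = 0} \<inter> {a..})"
proof -
  obtain T where T: "\<And>x. v x = 0 \<Longrightarrow> x \<le> T" using zeros_bounded_above by blast
  then have "{x. v x = 0} \<inter> {a..} \<subseteq> {x \<in> {a..T}. v x = 0}" by auto
  then show ?thesis using finite_simple_zeros[OF dv_acc acc_nonzero] finite_subset by blast
qed

section \<open>Ordering of heights and alternation of critical points\<close>

lemma crest_value_less:
  assumes "x < y" "v y = 0" "u0 c < u y"
  shows "u x < u y"
proof (rule ccontr)
  assume "\<not> u x < u y"
  \<comment> \<open>The kinetic term vanishes at \<open>y\<close> and is nonnegative at
    \<open>x\<close>, so this inequality of potentials contradicts the growth of the energy. As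
    \<open>x\<close> is arbitrary, a crest dominates everything to its left, not only earlier
    crests.\<close>
  then have "potential c (u x) \<le> potential c (u y)"
    using potential_decreasing[OF c, of "u y" "u x"] assms(3) u_less[of x] by (cases "u x = u y") auto
  moreover have "energy y = - potential c (u y)" using assms(2) by (simp add: energy_def)
  moreover have "energy x \<ge> - potential c (u x)" using k by (simp add: energy_def)
  ultimately show False using energy_less[OF assms(1)] by simp
qed

lemma trough_value_less:
  assumes "x < y" "v y = 0" "u y < u0 c"
  shows "u y < u x"
proof (rule ccontr)
  assume "\<not> u y < u x"
  then have "potential c (u x) \<le> potential c (u y)"
    using potential_increasing[of "u x" "u y" c] assms(3) u_pos[of x] by (cases "u x = u y") auto
  moreover have "energy y = - potential c (u y)" using assms(2) by (simp add: energy_def)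
  moreover have "energy x \<ge> - potential c (u x)" using k by (simp add: energy_def)
  ultimately show False using energy_less[OF assms(1)] by simp
qed

text \<open>Two neighbouring zeros at which \<open>v\<close> crosses in the same direction would
  enclose a further zero; the case of two maxima is handled by passing to
  \<open>- v\<close>.\<close>

lemma consecutive_zeros_alternate:
  assumes "p < q" "v p = 0" "v q = 0" and no: "\<And>x. p < x \<Longrightarrow> x < q \<Longrightarrow> v x \<noteq> 0"
  shows "acc p > 0 \<longleftrightarrow> acc q < 0"
proof -
  have "\<not> (acc p > 0 \<and> acc q > 0)"
    using zero_between_upcrossings[OF assms(1) cont_v dv_acc assms(2) _ dv_acc assms(3)] no by blast
  moreover have "\<not> (acc p < 0 \<and> acc q < 0)"
    using zero_between_upcrossings[OF assms(1) continuous_on_minus[OF cont_v] d_minus_v _ _ d_minus_v] assms(2,3) no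
    by fastforce
  ultimately show ?thesis using acc_nonzero[OF assms(2)] acc_nonzero[OF assms(3)] by linarith
qed

section \<open>The single inflection behind the last crest\<close>

lemma d_weighted_acc:
  "((\<lambda>x. exp (- (\<epsilon> / k) * x) * acc x) has_real_derivative
     exp (- (\<epsilon> / k) * x) * (force' c (u x) * v x / k)) (at x)"
proof -
  have "((\<lambda>x. force c (u x)) has_real_derivative force' c (u x) * v x) (at x)"
    by (rule DERIV_chain2[OF DERIV_force[OF u_less] du])
  then have "(acc has_real_derivative (\<epsilon> * acc x + force' c (u x) * v x) / k) (at x)"
    unfolding acc_def[abs_def] using dv[of x] k by (auto intro!: derivative_eq_intros)
  \<comment> \<open>The weight cancels the term \<open>\<epsilon> * acc x / k\<close>, leaving a
    derivative whose sign is read off from \<open>force'\<close> and \<open>v\<close>.\<close>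
  then show ?thesis using k by (auto intro!: derivative_eq_intros simp: field_simps)
qed

text \<open>As \<open>u\<close> falls from the crest to 0, \<open>force'\<close> changes sign once,
  so the weighted acceleration first increases and then decreases. It starts negative and, on the
  decreasing stretch, can never reach zero, which leaves one sign change.\<close>

lemma front_unique_inflection:
  assumes z0: "v z0 = 0" "acc z0 < 0" and v_neg: "\<And>x. x > z0 \<Longrightarrow> v x < 0"
  shows "\<exists>\<xi>0>z0. \<forall>\<xi>>z0. \<xi> \<noteq> \<xi>0 \<longrightarrow> (\<xi> - \<xi>0) * acc \<xi> > 0"
proof -
  define W where "W x = exp (- (\<epsilon> / k) * x) * acc x" for x
  have dW: "(W has_real_derivative exp (- (\<epsilon> / k) * x) * (force' c (u x) * v x / k)) (at x)" for x
    unfolding W_def[abs_def] by (rule d_weighted_acc)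
  have cW: "continuous_on S W" for S
    using dW by (meson DERIV_isCont continuous_at_imp_continuous_on)
  have W_sgn: "W x > 0 \<longleftrightarrow> acc x > 0" "W x < 0 \<longleftrightarrow> acc x < 0" for x
    by (simp_all add: W_def zero_less_mult_iff mult_less_0_iff)
  have u_dec: "u y < u x" if "z0 \<le> x" "x < y" for x y
    by (rule DERIV_neg_imp_decreasing_open[OF that(2) _ cont_u]) (use du v_neg that in force)
  \<comment> \<open>The value is \<open>c - 1 / c\<close>; at the other end
    \<open>force' c (u0 c)\<close> equals \<open>- alpha c\<close>. The zero \<open>us\<close>
    between them is the level where the monotonicity of \<open>W\<close> turns.\<close>
  have "force' c 0 > 0" using c one_less_power[OF c, of 2] by (simp add: force'_def power2_eq_square field_simps)
  moreover have "force' c (u0 c) < 0"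
    using alpha_pos u0_less[of c] by (simp add: force'_def alpha_eq_u0 power2_commute)
  moreover have "continuous_on {0..u0 c} (force' c)"
    unfolding force'_def[abs_def] using u0_less[of c] by (auto intro!: continuous_intros)
  ultimately obtain us where us: "0 \<le> us" "us \<le> u0 c" "force' c us = 0"
    using IVT2'[of "force' c" "u0 c" 0 0] u0_pos[OF c] by (auto simp: less_imp_le)
  have "us \<noteq> 0" using \<open>force' c 0 > 0\<close> us(3) by auto
  then have us_pos: "us > 0" using us by simp
  have "us < c" using us u0_less[of c] by simp
  have u_z0: "u0 c < u z0" using acc_neg_iff z0 by blast
  have "eventually (\<lambda>y. u y < us) at_top" using order_tendstoD(2)[OF u_top us_pos] .
  then obtain R where R: "\<And>y. y \<ge> R \<Longrightarrow> u y < us" by (auto simp: eventually_at_top_linorder)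
  obtain xs where xs: "z0 \<le> xs" "u xs = us"
    using IVT2'[of u "max R z0" us z0] cont_u less_imp_le[OF R[of "max R z0"]] u_z0 us(2) by force
  then have z0_xs: "z0 < xs" using u_z0 us(2) by (cases "z0 = xs") auto
  have W_inc: "W x < W y" if "z0 \<le> x" "x < y" "y \<le> xs" for x y
  proof (rule DERIV_pos_imp_increasing_open[OF that(2) _ cW])
    fix t assume t: "x < t" "t < y"
    have "us < u t" using u_dec[of t xs] t that xs by simp
    then have "force' c (u t) < 0" using force'_strict_antimono[of c us "u t"] u_less[of t] us(3) c by simp
    then have "exp (- (\<epsilon> / k) * t) * (force' c (u t) * v t / k) > 0"
      using v_neg[of t] t that k by (simp add: mult_neg_neg)
    then show "\<exists>z. (W has_real_derivative z) (at t) \<and> 0 < z" using dW by blast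
  qed
  have W_dec: "W y < W x" if "xs \<le> x" "x < y" for x y
  proof (rule DERIV_neg_imp_decreasing_open[OF that(2) _ cW])
    fix t assume t: "x < t" "t < y"
    have "u t < us" using u_dec[of xs t] t that xs by simp
    then have "force' c (u t) > 0" using force'_strict_antimono[of c "u t" us] \<open>us < c\<close> us(3) c by simp
    then have "exp (- (\<epsilon> / k) * t) * (force' c (u t) * v t / k) < 0"
      using v_neg[of t] t that k z0_xs by (simp add: mult_less_0_iff divide_less_0_iff)
    then show "\<exists>z. (W has_real_derivative z) (at t) \<and> z < 0" using dW by blast
  qed
  \<comment> \<open>If \<open>W\<close> had dropped to 0 it would stay negative afterwards; then
    \<open>v\<close> would be nonincreasing from a negative value on and could not tend to
    0.\<close>
  have acc_pos: "acc x > 0" if "xs \<le> x" for x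
  proof (rule ccontr)
    assume "\<not> acc x > 0"
    then have Wx: "W x \<le> 0" using W_sgn[of x] by (simp add: not_less[symmetric])
    have neg: "acc y \<le> 0" if "x < y" for y
      using W_dec[OF \<open>xs \<le> x\<close> that] Wx W_sgn[of y] by simp
    have "v y \<le> v (x + 1)" if "x + 1 \<le> y" for y
      using that by (rule DERIV_nonpos_imp_nonincreasing) (use dv_acc neg in force)
    then have "0 \<le> v (x + 1)"
      using v_top by (intro tendsto_upperbound[OF v_top]) (auto simp: eventually_at_top_linorder)
    then show False using v_neg[of "x + 1"] \<open>xs \<le> x\<close> z0_xs by simp
  qed
  have "W z0 < 0" "W xs > 0" using z0 W_sgn acc_pos by auto
  then obtain \<xi>0 where \<xi>0: "z0 \<le> \<xi>0" "\<xi>0 \<le> xs" "W \<xi>0 = 0"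
    using IVT'[of W z0 0 xs] cW z0_xs by auto
  have "\<xi>0 \<noteq> z0" using \<xi>0 \<open>W z0 < 0\<close> by auto
  moreover have "(\<xi> - \<xi>0) * acc \<xi> > 0" if "\<xi> > z0" "\<xi> \<noteq> \<xi>0" for \<xi>
  proof (cases "\<xi> < \<xi>0")
    case True
    then have "acc \<xi> < 0" using W_inc[of \<xi> \<xi>0] \<xi>0 that W_sgn by simp
    then show ?thesis using True by (simp add: mult_neg_neg)
  next
    case False
    then have gt: "\<xi>0 < \<xi>" using that by simp
    have "acc \<xi> > 0"
    proof (cases "\<xi> \<le> xs")
      case True
      then show ?thesis using W_inc[of \<xi>0 \<xi>] \<xi>0 gt W_sgn by simp
    qed (use acc_pos in simp)
    then show ?thesis using gt by simp
  qed
  ultimately show ?thesis using \<xi>0(1) by (intro exI[of _ \<xi>0]) auto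
qed

section \<open>Enumeration of the critical points\<close>

lemma v_neg_after_last_zero:
  assumes "v z = 0" and last: "\<And>x. v x = 0 \<Longrightarrow> x \<le> z"
  shows "acc z < 0" and "x > z \<Longrightarrow> v x < 0"
proof -
  show neg: "acc z < 0"
    using minimum_followed_by_maximum[OF assms(1)] last acc_nonzero[OF assms(1)]
    by (metis linorder_neqE_linordered_idom not_less)
  assume "x > z"
  obtain d where d: "d > 0" "\<And>h. 0 < h \<Longrightarrow> h < d \<Longrightarrow> - v (z + h) > 0"
    using has_real_derivative_pos_imp_signs[OF d_minus_v, of z] neg assms(1) by auto
  \<comment> \<open>A point between \<open>z\<close> and \<open>x\<close> at which \<open>v\<close>
    is already negative; a sign change before \<open>x\<close> would produce a zero beyond the last
    one.\<close>
  define y where "y = z + min d (x - z) / 2"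
  have y: "z < y" "y < x" "v y < 0"
    using d(1) d(2)[of "min d (x - z) / 2"] \<open>x > z\<close> by (auto simp: y_def min_def field_simps)
  show "v x < 0"
  proof (rule ccontr)
    assume "\<not> v x < 0"
    then obtain t where "t \<ge> y" "v t = 0" using IVT'[of v y 0 x] y cont_v by auto
    then show False using last[of t] y by simp
  qed
qed

text \<open>Numbered from the right, critical points alternate in type, and the last one is a
  maximum because a minimum has a maximum after it; hence parity of the index tells maxima from
  minima.\<close>

lemma critical_sequence:
  obtains s :: "nat \<Rightarrow> real" where "range s = {x. v x = 0}" "\<And>n. s (Suc n) < s n"
    "filterlim s at_bot sequentially" "\<And>n. acc (s n) < 0 \<longleftrightarrow> even n" "\<And>x. x > s 0 \<Longrightarrow> v x < 0"
proof -
  obtain s :: "nat \<Rightarrow> real" where rng: "range s = {x. v x = 0}" and dec: "\<And>n. s (Suc n) < s n"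
    and lim: "filterlim s at_bot sequentially"
    and gap: "\<And>n x. v x = 0 \<Longrightarrow> s (Suc n) < x \<Longrightarrow> s n \<le> x" and top: "\<And>x. v x = 0 \<Longrightarrow> x \<le> s 0"
  proof (rule enumerate_discrete_at_bot[OF zeros_finite])
    show "\<exists>x\<in>{x. v x = 0}. x < a" for a using zeros_unbounded_below by blast
  qed (rule that; simp)
  have v0: "v (s n) = 0" for n using rng by blast
  have sgn: "acc (s n) < 0 \<longleftrightarrow> even n" for n
  proof (induction n)
    case 0
    then show ?case using v_neg_after_last_zero(1)[OF v0 top] by simp
  next
    case (Suc n)
    have "acc (s (Suc n)) > 0 \<longleftrightarrow> acc (s n) < 0"
      using gap by (intro consecutive_zeros_alternate dec v0) (metis not_less)
    then show ?case using Suc acc_nonzero[OF v0, of "Suc n"] by (auto simp: not_less le_less)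
  qed
  from rng dec lim sgn v_neg_after_last_zero(2)[OF v0 top] show thesis by (rule that)
qed

lemma oscillation_profile:
  "(\<forall>\<xi>. u \<xi> > 0) \<and>
    (\<exists>z0.
      (bdd_above (range u) \<and> (\<forall>\<xi>. u \<xi> = (SUP x. u x) \<longleftrightarrow> \<xi> = z0) \<and> (\<forall>\<xi>>z0. v \<xi> < 0)) \<and>
      (\<exists>\<xi>0>z0. \<forall>\<xi>>z0. \<xi> \<noteq> \<xi>0 \<longrightarrow> (\<xi> - \<xi>0) * acc \<xi> > 0) \<and>
      (infinite {x. local_max_at u x} \<and> infinite {x. local_min_at u x} \<and>
       (\<exists>z w :: nat \<Rightarrow> real.
          z 0 = z0 \<and>
          {x. local_max_at u x} = range z \<and>
          {x. local_min_at u x} = w ` {1..} \<and>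
          (\<forall>i. z i > w (i + 1) \<and> w (i + 1) > z (i + 1)) \<and>
          filterlim z at_bot sequentially \<and>
          filterlim w at_bot sequentially \<and>
          (\<forall>i. u0 c < u (z (i + 1)) \<and> u (z (i + 1)) < u (z i)) \<and>
          (\<forall>i\<ge>1. u0 c > u (w (i + 1)) \<and> u (w (i + 1)) > u (w i)))))"
proof -
  obtain s :: "nat \<Rightarrow> real" where rng: "range s = {x. v x = 0}" and dec: "\<And>n. s (Suc n) < s n"
    and lim: "filterlim s at_bot sequentially"
    and sgn: "\<And>n. acc (s n) < 0 \<longleftrightarrow> even n" and v_neg: "\<And>x. x > s 0 \<Longrightarrow> v x < 0"
    by (rule critical_sequence) (rule that)
  have v0: "v (s n) = 0" for n using rng by blast
  have zero_in_range: "x \<in> range s" if "v x = 0" for x using that rng by simp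
  have sgn': "acc (s n) > 0 \<longleftrightarrow> odd n" for n
    using sgn[of n] acc_nonzero[OF v0, of n] by auto
  have s_less: "s m < s n" if "n < m" for n m
    using that by (induction rule: strict_inc_induct) (use dec in \<open>auto intro: less_trans\<close>)
  \<comment> \<open>To the left the energy comparison applies, to the right the wave is strictly
    decreasing.\<close>
  have peak: "u \<xi> < u (s 0)" if "\<xi> \<noteq> s 0" for \<xi>
  proof (cases "\<xi> < s 0")
    case True
    then show ?thesis using crest_value_less v0 acc_neg_iff[OF v0, of 0] sgn[of 0] by simp
  next
    case False
    then have "s 0 < \<xi>" using that by simp
    then show ?thesis
      by (rule DERIV_neg_imp_decreasing_open[OF _ _ cont_u]) (use du v_neg in blast)
  qed
  then have le: "u \<xi> \<le> u (s 0)" for \<xi> by (cases "\<xi> = s 0") (auto simp: less_imp_le)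
  have sup: "(SUP x. u x) = u (s 0)" by (rule cSup_eq_maximum) (auto simp: le)
  define z where "z i = s (2 * i)" for i
  \<comment> \<open>Truncated subtraction makes \<open>w 0\<close> equal to \<open>s 0\<close>, a
    maximum, so the minima are counted from index 1. The indices 0, 1, 3, 5 and so on still increase
    strictly, as the subsequence limit requires.\<close>
  define w where "w i = s (2 * i - 1)" for i
  have maxs: "{x. local_max_at u x} = range z"
  proof -
    have "x \<in> range z" if x: "v x = 0" "acc x < 0" for x
    proof -
      obtain n where "x = s n" using zero_in_range[OF x(1)] by blast
      then have "even n" using sgn x by simp
      then show ?thesis using \<open>x = s n\<close> by (auto simp: z_def elim!: evenE)
    qed
    then show ?thesis using v0 sgn by (auto simp: local_max_iff z_def)
  qed
  have mins: "{x. local_min_at u x} = w ` {1..}"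
  proof -
    have "x \<in> w ` {1..}" if x: "v x = 0" "acc x > 0" for x
    proof -
      obtain n where "x = s n" using zero_in_range[OF x(1)] by blast
      then have "odd n" using sgn' x by simp
      then obtain i where "n = 2 * i + 1" by (elim oddE)
      then show ?thesis using \<open>x = s n\<close> by (intro image_eqI[of _ _ "Suc i"]) (auto simp: w_def)
    qed
    then show ?thesis using v0 sgn' by (auto simp: local_min_iff w_def)
  qed
  have "inj z"
  proof (rule linorder_injI)
    fix i j :: nat assume "i < j"
    then have "z j < z i" unfolding z_def by (intro s_less) auto
    then show "z i \<noteq> z j" by simp
  qed
  then have inf_max: "infinite {x. local_max_at u x}" by (simp add: maxs range_inj_infinite)
  have "inj_on w {1..}"
  proof (rule linorder_inj_onI)
    fix i j :: nat assume "i < j" "i \<in> {1..}" "j \<in> {1..}"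
    then have "w j < w i" unfolding w_def by (intro s_less) auto
    then show "w i \<noteq> w j" by simp
  qed auto
  then have inf_min: "infinite {x. local_min_at u x}"
    by (simp add: mins finite_image_iff infinite_Ici)
  have lims: "filterlim z at_bot sequentially" "filterlim w at_bot sequentially"
    unfolding z_def[abs_def] w_def[abs_def]
    by (rule filterlim_compose[OF lim], rule filterlim_subseq, force simp: strict_mono_def)+
  have order: "z i > w (i + 1)" "w (i + 1) > z (i + 1)" for i
    unfolding z_def w_def by (intro s_less; simp)+
  have z_val: "u0 c < u (z i)" for i using acc_neg_iff[OF v0, of "2 * i"] sgn[of "2 * i"] by (simp add: z_def)
  have w_val: "u0 c > u (w i)" if "i \<ge> 1" for i using acc_pos_iff[OF v0, of "2 * i - 1"] sgn'[of "2 * i - 1"] that by (simp add: w_def)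
  have z_dec: "u (z (i + 1)) < u (z i)" for i
    by (rule crest_value_less[OF less_trans[OF order(2,1)] _ z_val]) (simp add: z_def v0)
  have w_inc: "u (w (i + 1)) > u (w i)" if "i \<ge> 1" for i
    by (rule trough_value_less[OF _ _ w_val[OF that]])
       (use that in \<open>auto simp: w_def v0 intro!: s_less\<close>)
  have bdd: "bdd_above (range u)" using le by (rule bdd_aboveI2)
  have attained: "\<forall>\<xi>. u \<xi> = (SUP x. u x) \<longleftrightarrow> \<xi> = s 0"
    using peak unfolding sup by (metis less_irrefl)
  have front: "\<forall>\<xi>>s 0. v \<xi> < 0" using v_neg by blast
  have inflection: "\<exists>\<xi>0>s 0. \<forall>\<xi>>s 0. \<xi> \<noteq> \<xi>0 \<longrightarrow> (\<xi> - \<xi>0) * acc \<xi> > 0"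
    using front_unique_inflection[OF v0 _ v_neg] sgn[of 0] by simp
  have z_0: "z 0 = s 0" by (simp add: z_def)
  have interlace: "\<forall>i. z i > w (i + 1) \<and> w (i + 1) > z (i + 1)" using order by blast
  have crests: "\<forall>i. u0 c < u (z (i + 1)) \<and> u (z (i + 1)) < u (z i)" using z_val z_dec by blast
  have troughs: "\<forall>i\<ge>1. u0 c > u (w (i + 1)) \<and> u (w (i + 1)) > u (w i)" using w_val w_inc by simp
  show ?thesis
    by (rule conjI, simp add: u_pos, rule exI[of _ "s 0"], intro conjI)
      (fact bdd attained front inflection inf_max inf_min |
        (rule exI[of _ z], rule exI[of _ w], intro conjI; fact z_0 maxs mins interlace lims crests troughs))+
qed

end

section \<open>From travelling waves to orbits\<close>

lemma travelling_wave_orbit: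
  assumes "\<epsilon> > 0" and "\<delta> > 0" and "c > 1"
    and "\<epsilon>\<^sup>2 < 4 * \<delta> * c * alpha c"
    and wave: "travelling_wave \<epsilon> \<delta> c u"
  shows "wave_orbit (\<delta> * c) \<epsilon> c u (deriv u)"
proof -
  from wave have smooth: "smooth u" and ne: "\<And>x. u x \<noteq> c"
    and ode: "\<And>x. - c * u x - u x / (u x - c) + (1/2) * (u x)\<^sup>2
            + \<delta> * c * deriv (deriv u) x - \<epsilon> * deriv u x = 0"
    and top: "((\<lambda>x. (eta c u x, u x)) \<longlongrightarrow> (0, 0)) at_top"
    and derivs: "\<And>j. j \<ge> 1 \<Longrightarrow> ((\<lambda>x. ((deriv ^^ j) (eta c u) x, (deriv ^^ j) u x)) \<longlongrightarrow> (0, 0)) at_bot"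
      "\<And>j. j \<ge> 1 \<Longrightarrow> ((\<lambda>x. ((deriv ^^ j) (eta c u) x, (deriv ^^ j) u x)) \<longlongrightarrow> (0, 0)) at_top"
    by (auto simp: travelling_wave_def)
  from wave obtain \<eta>m um where pos: "\<eta>m > 0" "um > 0"
    and bot: "((\<lambda>x. (eta c u x, u x)) \<longlongrightarrow> (\<eta>m, um)) at_bot"
    by (auto simp: travelling_wave_def)
  have diff: "((deriv ^^ j) u has_real_derivative (deriv ^^ Suc j) u x) (at x)" for j x
    using smooth unfolding smooth_def by (simp add: DERIV_deriv_iff_real_differentiable differentiable_on_def)
  have du: "(u has_real_derivative deriv u x) (at x)" for x using diff[of 0] by simp
  have ddu: "(deriv u has_real_derivative deriv (deriv u) x) (at x)" for x using diff[of 1] by simp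
  have u_top: "(u \<longlongrightarrow> 0) at_top" using tendsto_snd[OF top] by simp
  have u_bot: "(u \<longlongrightarrow> um) at_bot" using tendsto_snd[OF bot] by simp
  have eta_bot: "(eta c u \<longlongrightarrow> \<eta>m) at_bot" using tendsto_fst[OF bot] by simp
  have v_top: "(deriv u \<longlongrightarrow> 0) at_top" using tendsto_snd[OF derivs(2)[of 1]] by simp
  have v_bot: "(deriv u \<longlongrightarrow> 0) at_bot" using tendsto_snd[OF derivs(1)[of 1]] by simp
  have a_bot: "(deriv (deriv u) \<longlongrightarrow> 0) at_bot" using tendsto_snd[OF derivs(1)[of 2]] by (simp add: numeral_2_eq_2)
  \<comment> \<open>The wave ends below \<open>c\<close> and never equals \<open>c\<close>, so by
    continuity it is below \<open>c\<close> throughout.\<close>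
  have u_less: "u x < c" for x
  proof (rule ccontr)
    assume "\<not> u x < c"
    moreover have "eventually (\<lambda>y. u y < c) at_top" using order_tendstoD(2)[OF u_top, of c] \<open>c > 1\<close> by simp
    then obtain R where "\<And>y. y \<ge> R \<Longrightarrow> u y < c" by (auto simp: eventually_at_top_linorder)
    moreover have "continuous_on {x..max R x} u"
      using du by (meson DERIV_isCont continuous_at_imp_continuous_on)
    ultimately have "\<exists>y\<ge>x. y \<le> max R x \<and> u y = c" by (intro IVT2') (auto simp: less_imp_le)
    then show False using ne by blast
  qed
  have "um \<le> c" using u_bot by (rule tendsto_upperbound) (auto simp: less_imp_le[OF u_less])
  \<comment> \<open>Here the finiteness of the limit of \<open>eta\<close> enters: \<open>u\<close>
    is \<open>eta c u\<close> times \<open>c - u\<close>, which would tend to 0 if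
    \<open>um = c\<close>, whereas \<open>um\<close> is positive.\<close>
  moreover have "um \<noteq> c"
  proof
    assume "um = c"
    have "((\<lambda>x. eta c u x * (c - u x)) \<longlongrightarrow> \<eta>m * (c - um)) at_bot"
      by (intro tendsto_intros eta_bot u_bot)
    moreover have "(\<lambda>x. eta c u x * (c - u x)) = u" using ne[THEN not_sym] by (auto simp: eta_def)
    ultimately have "\<eta>m * (c - um) = um" using u_bot tendsto_unique trivial_limit_at_bot_linorder by metis
    then show False using \<open>um = c\<close> pos by simp
  qed
  ultimately have um_less: "um < c" by simp
  have acc: "deriv (deriv u) x = (\<epsilon> * deriv u x + force c (u x)) / (\<delta> * c)" for x
  proof -
    have "u x / (u x - c) = - (u x / (c - u x))" by (metis minus_diff_eq divide_minus_right)
    then show ?thesis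
      using ode[of x] assms by (simp add: force_def eq_divide_eq algebra_simps)
  qed
  \<comment> \<open>Since both derivatives tend to 0, the limit of the equation makes
    \<open>um\<close> a zero of the force, and \<open>u0 c\<close> is the only one strictly between
    0 and \<open>c\<close>.\<close>
  have "isCont (force c) um" by (rule DERIV_isCont[OF DERIV_force[OF um_less]])
  then have "((\<lambda>x. force c (u x)) \<longlongrightarrow> force c um) at_bot"
    using u_bot isCont_tendsto_compose by blast
  moreover have "force c (u x) = \<delta> * c * deriv (deriv u) x - \<epsilon> * deriv u x" for x
    using assms acc[of x] by simp
  moreover have "((\<lambda>x. \<delta> * c * deriv (deriv u) x - \<epsilon> * deriv u x) \<longlongrightarrow> \<delta> * c * 0 - \<epsilon> * 0) at_bot"
    by (intro tendsto_intros a_bot v_bot)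
  ultimately have "force c um = 0" using tendsto_unique trivial_limit_at_bot_linorder by fastforce
  then have "um = u0 c"
    using force_pos[OF pos(2), of c] force_neg[OF pos(2) _ um_less] by (cases um "u0 c" rule: linorder_cases) auto
  then show ?thesis
    using assms du ddu u_less u_top v_top u_bot by unfold_locales (auto simp: acc[symmetric] mult.assoc)
qed

theorem theorem3p2:
  fixes \<epsilon> \<delta> c :: real and u :: "real \<Rightarrow> real"
  assumes "\<epsilon> > 0" and "\<delta> > 0" and "c > 1"
    and "\<epsilon>\<^sup>2 < 4 * \<delta> * c * alpha c"
    and "travelling_wave \<epsilon> \<delta> c u"
  shows "(\<forall>\<xi>. u \<xi> > 0) \<and>
    (\<exists>z0.
      \<comment> \<open>(a)\<close>
      (bdd_above (range u) \<and>
       (\<forall>\<xi>. u \<xi> = (SUP x. u x) \<longleftrightarrow> \<xi> = z0) \<and>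
       (\<forall>\<xi>>z0. deriv u \<xi> < 0)) \<and>
      \<comment> \<open>(b)\<close>
      (\<exists>\<xi>0>z0. \<forall>\<xi>>z0. \<xi> \<noteq> \<xi>0 \<longrightarrow> (\<xi> - \<xi>0) * deriv (deriv u) \<xi> > 0) \<and>
      \<comment> \<open>(c)\<close>
      (infinite {x. local_max_at u x} \<and> infinite {x. local_min_at u x} \<and>
       (\<exists>z w :: nat \<Rightarrow> real.
          z 0 = z0 \<and>
          {x. local_max_at u x} = range z \<and>
          {x. local_min_at u x} = w ` {1..} \<and>
          (\<forall>i. z i > w (i + 1) \<and> w (i + 1) > z (i + 1)) \<and>
          filterlim z at_bot sequentially \<and>
          filterlim w at_bot sequentially \<and>
          (\<forall>i. u0 c < u (z (i + 1)) \<and> u (z (i + 1)) < u (z i)) \<and>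
          (\<forall>i\<ge>1. u0 c > u (w (i + 1)) \<and> u (w (i + 1)) > u (w i)))))"
proof -
  interpret wave_orbit "\<delta> * c" \<epsilon> c u "deriv u"
    using assms by (rule travelling_wave_orbit)
  have "deriv (deriv u) = acc" using dv_acc DERIV_imp_deriv by blast
  then show ?thesis using oscillation_profile by simp
qed

end
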